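(* Let $G$ be a strongly connected graph with $N$ nodes, girth $g$ and cyclicity $\gamma$. Then the exploration penalty $ep$ of $G$ is finite and \[ ep \le \min\Big\{ N+(N-2)g\ ,\ 2\frac{g}{\gamma}N - \frac{g}{\gamma} - 2g + \gamma\Big\}. \]
   Context: Graphs are directed graphs $(V,E)$ with $V$ finite nonempty and $E\subseteq V\times V$. A walk is a finite sequence of consecutive edges (possibly empty); a closed walk starts and ends at the same node; a cycle is a closed walk containing no nonempty closed walk as a proper subwalk. The girth $g$ is the minimal length of a nonempty cycle (so $G$ is assumed to contain a nonempty cycle); the cyclicity $\gamma$ of a strongly connected graph is the gcd of its cycle lengths. The exploration penalty $ep(G)$ is the least integer $e$ such that for every node $i$ and every integer $n\ge e$ that is a multiple of $\gamma$, there is a closed walk of length $n$ starting at $i$. *)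

theory Defs
  imports Complex_Main "Graph_Theory.Graph_Theory" "HOL-Library.Sublist"
begin

text \<open>
  Unlike the constant \<open>cycle\<close> of \<open>Graph_Theory\<close>, the empty walk at a node counts as a
  cycle here.  Subwalks are contiguous sublists.
\<close>

definition walk_cycle :: "('a, 'b) pre_digraph \<Rightarrow> 'b list \<Rightarrow> bool" where
  "walk_cycle G p \<longleftrightarrow>
     (\<exists>u. pre_digraph.awalk G u p u) \<and>
     \<not> (\<exists>q v. strict_sublist q p \<and> q \<noteq> [] \<and> pre_digraph.awalk G v q v)"

definition girth :: "('a, 'b) pre_digraph \<Rightarrow> nat" where
  "girth G = (LEAST n. \<exists>p. walk_cycle G p \<and> p \<noteq> [] \<and> length p = n)"

text \<open>The empty cycle contributes length 0, which does not affect the gcd.\<close>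

definition cyclicity :: "('a, 'b) pre_digraph \<Rightarrow> nat" where
  "cyclicity G = Gcd {length p | p. walk_cycle G p}"

definition closed_walks_from :: "('a, 'b) pre_digraph \<Rightarrow> int \<Rightarrow> bool" where
  "closed_walks_from G e \<longleftrightarrow>
     (\<forall>i \<in> verts G. \<forall>n \<ge> e. int (cyclicity G) dvd n \<longrightarrow>
        (\<exists>p. pre_digraph.awalk G i p i \<and> int (length p) = n))"

text \<open>
  The penalty ranges over the integers, so it is \<open>1 - cyclicity G\<close> if closed walks of all
  admissible lengths exist at every node.  The value of \<open>exploration_penalty\<close> is only
  meaningful if \<open>finite_exploration_penalty\<close> holds, that is, if a least such integer exists.
\<close>

definition finite_exploration_penalty :: "('a, 'b) pre_digraph \<Rightarrow> bool" where
  "finite_exploration_penalty G \<longleftrightarrow>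
     (\<exists>e. closed_walks_from G e \<and> (\<forall>e'. closed_walks_from G e' \<longrightarrow> e \<le> e'))"

definition exploration_penalty :: "('a, 'b) pre_digraph \<Rightarrow> int" where
  "exploration_penalty G = (LEAST e. closed_walks_from G e)"

end

theory Submission
  imports Defs "HOL-Number_Theory.Cong"
begin

text \<open>
  Walk lengths modulo \<open>\<gamma>\<close> partition the nodes into \<open>\<gamma>\<close> cyclic classes; some class \<open>S\<close> has
  \<open>m \<le> N / \<gamma>\<close> nodes.  A cycle \<open>c\<close> of length \<open>g\<close> visits \<open>h = g / \<gamma>\<close> distinct nodes of \<open>S\<close>.
  Starting at \<open>i\<close>, walk fewer than \<open>\<gamma>\<close> steps to \<open>S\<close>, then in steps of length \<open>\<gamma>\<close> reach \<open>c\<close>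
  inside \<open>S\<close> after at most \<open>m - h\<close> of them.  Steps of length \<open>g\<close> still connect \<open>S\<close> strongly and
  are loops at the nodes of \<open>c\<close>, so exactly \<open>m - 1\<close> of them lead to any prescribed node of \<open>S\<close>,
  in particular to one from which \<open>i\<close> is reached in the missing number of steps.  Turning around
  on \<open>c\<close> absorbs any surplus, which gives closed walks of all lengths \<open>n \<ge> \<gamma> + M\<close> divisible by
  \<open>\<gamma>\<close>, where \<open>M = \<gamma> (m - h) + g (m - 1)\<close>; the summand \<open>\<gamma>\<close> disappears for \<open>i \<in> S\<close>.  As
  \<open>\<gamma>\<close> divides \<open>M\<close>, the penalty is at most \<open>M + 1\<close>, and at most \<open>M\<close> if \<open>\<gamma> = 1\<close>, which lies
  below both bounds.
\<close>

section \<open>Powers of relations and additive submonoids\<close>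

lemma relpow_trans: "(u, v) \<in> R ^^ m \<Longrightarrow> (v, w) \<in> R ^^ n \<Longrightarrow> (u, w) \<in> R ^^ (m + n)"
  by (auto simp: relpow_add)

lemma relpow_closed_mult: "(u, u) \<in> R ^^ m \<Longrightarrow> (u, u) \<in> R ^^ (k * m)"
  by (induction k) (auto intro: relpow_trans)

lemma relpow_subset_Times:
  assumes "R \<subseteq> A \<times> A" "(u, v) \<in> R ^^ n" "u \<in> A"
  shows "v \<in> A"
  using assms(2,3)
proof (induction n arbitrary: v)
  case (Suc n)
  then show ?case using assms(1) by auto
qed simp

lemma relpow_of_relpow:
  fixes R :: "'a rel"
  assumes "(u, v) \<in> (R ^^ k) ^^ n"
  shows "(u, v) \<in> R ^^ (k * n)"
  using assms
proof (induction n arbitrary: v)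
  case (Suc n)
  then obtain w where "(u, w) \<in> R ^^ (k * n)" "(w, v) \<in> R ^^ k" by auto
  then show ?case using relpow_trans by (metis mult_Suc_right add.commute)
qed simp

lemma relpow_Restr: "(u, v) \<in> (Restr R A) ^^ n \<Longrightarrow> (u, v) \<in> R ^^ n"
  by (induction n arbitrary: v) auto

lemma rtrancl_crossing:
  assumes "(u, t) \<in> R\<^sup>*" "u \<notin> A" "t \<in> A"
  shows "\<exists>x y. (x, y) \<in> R \<and> x \<notin> A \<and> y \<in> A"
  using assms by (induction rule: rtrancl_induct) auto

text \<open>Let \<open>B k\<close> collect the points that reach \<open>T\<close> within
  \<open>k\<close> steps. It starts at \<open>T\<close>, and as long as it is not all of
  \<open>S\<close>, some pair of \<open>R\<close> enters it from outside, so it gains a point with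
  each step.\<close>

lemma relpow_hits_within_card:
  assumes fin: "finite S" and R: "R \<subseteq> S \<times> S" and T: "T \<subseteq> S"
    and reach: "\<And>u. u \<in> S \<Longrightarrow> \<exists>t\<in>T. (u, t) \<in> R\<^sup>*"
    and u: "u \<in> S"
  shows "\<exists>k \<le> card S - card T. \<exists>t\<in>T. (u, t) \<in> R ^^ k"
proof -
  define B where "B k = {x \<in> S. \<exists>j\<le>k. \<exists>t\<in>T. (x, t) \<in> R ^^ j}" for k
  have BS: "B k \<subseteq> S" for k by (auto simp: B_def)
  have TB: "T \<subseteq> B k" for k using T by (auto simp: B_def intro!: exI[of _ 0])
  have mono: "B k \<subseteq> B (Suc k)" for k by (auto simp: B_def intro: le_SucI)
  have finB: "finite (B k)" for k using BS fin by (rule finite_subset)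
  have growth: "B k = S \<or> card T + k \<le> card (B k)" for k
  proof (induction k)
    case 0
    then show ?case using card_mono[OF finB TB, of 0] by simp
  next
    case (Suc k)
    show ?case
    proof (cases "B k = S")
      case True
      then show ?thesis using mono[of k] BS[of "Suc k"] by blast
    next
      case False
      then obtain x0 where x0: "x0 \<in> S" "x0 \<notin> B k" using BS[of k] by blast
      obtain t where "t \<in> T" "(x0, t) \<in> R\<^sup>*" using reach[OF x0(1)] by blast
      then obtain x y where xy: "(x, y) \<in> R" "x \<notin> B k" "y \<in> B k"
        using rtrancl_crossing[of x0 t R "B k"] x0 TB[of k] by blast
      then obtain j t' where "j \<le> k" "t' \<in> T" "(y, t') \<in> R ^^ j" by (auto simp: B_def)
      moreover have "(x, t') \<in> R ^^ Suc j" using xy(1) calculation(3) by (rule relpow_Suc_I2)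
      ultimately have "x \<in> B (Suc k)"
        using xy(1) R unfolding B_def by (blast intro: Suc_le_mono[THEN iffD2])
      then have "B k \<subset> B (Suc k)" using mono xy by blast
      then have "card (B k) < card (B (Suc k))" by (rule psubset_card_mono[OF finB])
      then show ?thesis using Suc False by simp
    qed
  qed
  have "B (card S - card T) = S"
    using growth[of "card S - card T"] card_mono[OF fin T] BS fin
    by (metis card_seteq le_add_diff_inverse)
  then show ?thesis using u by (auto simp: B_def)
qed

text \<open>Modulo a positive element the monoid becomes a group, so it represents its own gcd.\<close>

lemma Gcd_cong_submonoid:
  fixes L :: "nat set"
  assumes zero: "0 \<in> L" and add: "\<And>x y. x \<in> L \<Longrightarrow> y \<in> L \<Longrightarrow> x + y \<in> L" and g: "0 < g" "g \<in> L"
  shows "\<exists>x\<in>L. [x = Gcd L] (mod g)"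
proof -
  define I where "I = {z. \<exists>x\<in>L. [x = z] (mod g)}"
  have mul: "k * x \<in> L" if "x \<in> L" for k x
    by (induction k) (use that zero add in auto)
  have Imul: "k * z \<in> I" if "z \<in> I" for k z
    using that mul unfolding I_def by (auto intro: cong_scalar_left)
  have Iadd: "y + z \<in> I" if "y \<in> I" "z \<in> I" for y z
    using that add unfolding I_def by (auto intro: cong_add)
  have LI: "L \<subseteq> I" by (auto simp: I_def intro: cong_refl)
  define d where "d = (LEAST z. z \<in> I \<and> 0 < z)"
  have "g \<in> I \<and> 0 < g" using g LI by auto
  then have d: "d \<in> I" "0 < d" unfolding d_def by (metis (mono_tags, lifting) LeastI)+
  have dmin: "d \<le> z" if "z \<in> I" "0 < z" for z
    unfolding d_def using that by (simp add: Least_le)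
  have "d dvd x" if "x \<in> L" for x
  proof -
    \<comment> \<open>Modulo \<open>g\<close> the factor \<open>g - 1\<close> acts as -1, so
      division with remainder by \<open>d\<close> stays inside \<open>I\<close>; the remainder then
      contradicts the minimality of \<open>d\<close> unless it is 0.\<close>
    have eq: "x + (g - 1) * (x div d * d) = x mod d + g * (x div d * d)"
    proof -
      have "g = Suc (g - 1)" using g by simp
      then have "g * (x div d * d) = x div d * d + (g - 1) * (x div d * d)"
        by (metis mult_Suc)
      then show ?thesis using div_mult_mod_eq[of x d] by linarith
    qed
    have "x + (g - 1) * (x div d * d) \<in> I"
      using LI that Iadd Imul d by (metis subsetD)
    then have "x mod d + g * (x div d * d) \<in> I" by (simp only: eq)
    then have "x mod d \<in> I" unfolding I_def by (simp add: cong_def)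
    then show ?thesis using dmin[of "x mod d"] d(2) by (metis dvd_eq_mod_eq_0 gr_zeroI leD mod_less_divisor)
  qed
  then have "d dvd Gcd L" by (rule Gcd_greatest)
  then have "Gcd L \<in> I" using Imul[OF d(1)] by (metis dvd_div_mult_self)
  then show ?thesis by (auto simp: I_def)
qed

section \<open>Cyclic classes of a strongly connected relation\<close>

text \<open>The shortest cycle is a \<open>g\<close>-periodic infinite sequence, so that turning
  around on it any number of times is mere index addition.\<close>

locale cyclic_relation =
  fixes V :: "'a set" and E :: "'a rel" and g \<gamma> :: nat and c :: "nat \<Rightarrow> 'a"
  assumes fin: "finite V" and E: "E \<subseteq> V \<times> V"
    and strong: "u \<in> V \<Longrightarrow> v \<in> V \<Longrightarrow> (u, v) \<in> E\<^sup>*"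
    and g_pos: "0 < g"
    and c_arc: "(c t, c (Suc t)) \<in> E" and c_periodic: "c (t + g) = c t"
    and c_inj: "inj_on c {..<g}"
    and gamma: "\<gamma> = Gcd {n. \<exists>u. (u, u) \<in> E ^^ n}"
begin

lemma c_in: "c t \<in> V"
  using c_arc[of t] E by auto

lemma c_walk: "(c t, c (t + k)) \<in> E ^^ k"
  by (induction k) (auto intro: c_arc)

lemma c_mult: "c (t + k * g) = c t"
proof (induction k)
  case (Suc k)
  have "t + Suc k * g = t + k * g + g" by simp
  then show ?case using Suc by (simp only: c_periodic)
qed simp

lemma c_loop: "(c t, c t) \<in> E ^^ g"
  using c_walk[of t g] by (simp add: c_periodic)

lemma walk_exists: "u \<in> V \<Longrightarrow> v \<in> V \<Longrightarrow> \<exists>n. (u, v) \<in> E ^^ n"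
  using strong rtrancl_power by blast

lemma gamma_dvd: "(u, u) \<in> E ^^ n \<Longrightarrow> \<gamma> dvd n"
  unfolding gamma by (rule Gcd_dvd) auto

lemma gamma_dvd_g: "\<gamma> dvd g"
  using c_loop gamma_dvd by blast

lemma gamma_pos: "0 < \<gamma>"
  using gamma_dvd_g g_pos by (auto intro: Nat.gr0I)

text \<open>A detour from \<open>u\<close> to \<open>w\<close> and back can be made with or without
  a closed walk at \<open>w\<close>; the two lengths differ by the length of that closed
  walk.\<close>

lemma gamma_eq_Gcd_at:
  assumes "u \<in> V"
  shows "\<gamma> = Gcd {n. (u, u) \<in> E ^^ n}"
proof (rule dvd_antisym)
  show "\<gamma> dvd Gcd {n. (u, u) \<in> E ^^ n}" by (rule Gcd_greatest) (auto intro: gamma_dvd)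
  have "Gcd {n. (u, u) \<in> E ^^ n} dvd n" if n: "(w, w) \<in> E ^^ n" for n w
  proof (cases "n = 0")
    case False
    have "w \<in> V"
      using n E False by (cases n) auto
    then obtain a b where a: "(u, w) \<in> E ^^ a" and b: "(w, u) \<in> E ^^ b"
      using walk_exists assms by meson
    have "(u, u) \<in> E ^^ (a + b)" "(u, u) \<in> E ^^ (a + n + b)"
      using a b n by (blast intro: relpow_trans)+
    then have "Gcd {n. (u, u) \<in> E ^^ n} dvd a + b" "Gcd {n. (u, u) \<in> E ^^ n} dvd a + n + b"
      by (auto intro!: Gcd_dvd)
    then show ?thesis by (metis add.assoc add.commute dvd_add_right_iff)
  qed simp
  then show "Gcd {n. (u, u) \<in> E ^^ n} dvd \<gamma>" unfolding gamma by (auto intro!: Gcd_greatest)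
qed

text \<open>The cyclic class of \<open>v\<close>, counted from \<open>c 0\<close>; by
  \<open>cl_eq\<close> the chosen walk is immaterial.\<close>

definition cl :: "'a \<Rightarrow> nat" where
  "cl v = (SOME n. (c 0, v) \<in> E ^^ n) mod \<gamma>"

text \<open>Two walks to \<open>v\<close> become closed walks through the same return walk, so their
  lengths agree modulo \<gamma>.\<close>

lemma cl_eq:
  assumes "(c 0, v) \<in> E ^^ n"
  shows "cl v = n mod \<gamma>"
proof -
  define n' where "n' = (SOME n. (c 0, v) \<in> E ^^ n)"
  have n': "(c 0, v) \<in> E ^^ n'" unfolding n'_def using assms by (rule someI)
  have "v \<in> V" using relpow_subset_Times[OF E assms c_in] .
  then obtain k where k: "(v, c 0) \<in> E ^^ k" using walk_exists c_in by blast
  have "\<gamma> dvd n + k" "\<gamma> dvd n' + k"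
    using relpow_trans assms n' k gamma_dvd by metis+
  then have "[n + k = n' + k] (mod \<gamma>)" by (simp add: cong_def mod_eq_0_iff_dvd)
  then have "[n = n'] (mod \<gamma>)" by (simp only: cong_add_rcancel_nat)
  then show ?thesis by (simp add: cl_def n'_def cong_def)
qed

lemma cl_walk:
  assumes "u \<in> V" "(u, v) \<in> E ^^ n"
  shows "cl v = (cl u + n) mod \<gamma>"
proof -
  obtain a where a: "(c 0, u) \<in> E ^^ a" using walk_exists c_in assms by blast
  show ?thesis using cl_eq[OF a] cl_eq[OF relpow_trans[OF a assms(2)]] by (simp add: mod_simps)
qed

lemma cl_c: "cl (c t) = t mod \<gamma>"
  using cl_eq c_walk[of 0 t] by simp

lemma cl_less: "cl v < \<gamma>"
  using gamma_pos by (simp add: cl_def)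

lemma dvd_walk_length:
  assumes "u \<in> V" "(u, v) \<in> E ^^ n" "cl u = cl v"
  shows "\<gamma> dvd n"
proof -
  have "[cl u + n = cl u + 0] (mod \<gamma>)"
    using cl_walk[OF assms(1,2)] assms(3) cl_less[of u] by (simp add: cong_def)
  then have "[n = 0] (mod \<gamma>)" by (simp only: cong_add_lcancel_nat)
  then show ?thesis by (simp add: cong_0_iff)
qed

text \<open>Some closed walk at \<open>u\<close> has a length congruent to \<gamma> modulo
  \<open>g\<close>. Run \<open>(g - 1) * k\<close> times before a walk of length
  \<open>\<gamma> * k\<close> from \<open>u\<close> to \<open>v\<close>, it cancels that length
  modulo \<open>g\<close>.\<close>

lemma walk_multiple_g:
  assumes "u \<in> V" "v \<in> V" "cl u = cl v"
  shows "\<exists>n. (u, v) \<in> E ^^ (g * n)"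
proof -
  obtain a where a: "(u, v) \<in> E ^^ a" using walk_exists assms by blast
  obtain k where k: "a = \<gamma> * k" using dvd_walk_length[OF assms(1) a assms(3)] by blast
  let ?L = "{n. (u, u) \<in> E ^^ n}"
  obtain p q where p: "(u, c 0) \<in> E ^^ p" and q: "(c 0, u) \<in> E ^^ q"
    using walk_exists c_in assms by meson
  \<comment> \<open>The gcd lemma needs a modulus that is itself the length of a closed walk at
    \<open>u\<close>; a positive multiple \<open>l\<close> of \<open>g\<close> serves. If
    \<open>p + q = 0\<close>, then \<open>u\<close> is \<open>c 0\<close> and \<open>g\<close>
    qualifies.\<close>
  have "g * (p + q) \<in> ?L" using relpow_closed_mult[OF relpow_trans[OF p q]] by simp
  moreover have "0 < g * (p + q) \<or> p + q = 0" using g_pos by auto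
  moreover have "g \<in> ?L" if "p + q = 0" using that p c_loop[of 0] by simp
  ultimately obtain l where l: "0 < l" "l \<in> ?L" "g dvd l" by (metis dvd_triv_left dvd_refl g_pos)
  have "\<exists>x\<in>?L. [x = Gcd ?L] (mod l)"
    by (rule Gcd_cong_submonoid) (use l in \<open>auto intro: relpow_trans\<close>)
  then obtain x where x: "(u, u) \<in> E ^^ x" "[x = \<gamma>] (mod l)"
    using gamma_eq_Gcd_at[OF assms(1)] by auto
  have "[x = \<gamma>] (mod g)" using x(2) l(3) by (rule cong_dvd_modulus_nat)
  then have "[(g - 1) * k * x + a = (g - 1) * k * \<gamma> + a] (mod g)"
    by (intro cong_add cong_scalar_left cong_refl)
  moreover have "(g - 1) * k * \<gamma> + a = g * (k * \<gamma>)"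
    using g_pos k by (cases g) auto
  ultimately have "g dvd (g - 1) * k * x + a"
    by (metis cong_dvd_iff dvd_triv_left)
  moreover have "(u, v) \<in> E ^^ ((g - 1) * k * x + a)"
    using relpow_closed_mult[OF x(1)] a by (rule relpow_trans)
  ultimately show ?thesis by (metis dvdE)
qed

text \<open>Restricting the steps to one class lets \<open>relpow_hits_within_card\<close> count the
  nodes of that class instead of all of \<open>V\<close>.\<close>

lemma walk_to_rtrancl_in_class:
  assumes "(u, v) \<in> E ^^ (l * n)" "u \<in> V" "\<gamma> dvd l"
  shows "(u, v) \<in> (Restr (E ^^ l) {x \<in> V. cl x = cl u})\<^sup>*"
  using assms(1)
proof (induction n arbitrary: v)
  case (Suc n)
  then obtain w where w: "(u, w) \<in> E ^^ (l * n)" "(w, v) \<in> E ^^ l"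
    by (auto simp: add.commute[of l] relpow_add)
  have "w \<in> V" "v \<in> V" using relpow_subset_Times[OF E] w assms(2) by blast+
  moreover obtain j where "l = \<gamma> * j" using assms(3) by blast
  then have "cl w = cl u" "cl v = cl w"
    using cl_walk[OF assms(2) w(1)] cl_walk[OF \<open>w \<in> V\<close> w(2)] cl_less
    by (simp_all add: mult.assoc)
  ultimately show ?case using Suc.IH[OF w(1)] w(2) by (auto intro: rtrancl_into_rtrancl)
qed simp

lemma walk_from:
  assumes "u \<in> V"
  shows "\<exists>x. (u, x) \<in> E ^^ d"
proof -
  obtain a where "(u, c 0) \<in> E ^^ a" using walk_exists c_in assms by blast
  then have "(u, c (0 + d)) \<in> E ^^ (d + a)"
    using relpow_trans[OF _ c_walk[of 0 d]] by (simp add: add.commute)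
  then show ?thesis by (auto simp: relpow_add)
qed

lemma walk_into:
  assumes "u \<in> V"
  shows "\<exists>x\<in>V. (x, u) \<in> E ^^ d"
proof -
  obtain b where b: "(c 0, u) \<in> E ^^ b" using walk_exists c_in assms by blast
  \<comment> \<open>The index \<open>d * g\<close> is a multiple of the period and at least
    \<open>d\<close>, so one can step back \<open>d\<close> places from it without
    truncation.\<close>
  have "(c (d * g - d), c (d * g - d + d)) \<in> E ^^ d" by (rule c_walk)
  moreover have "d * g - d + d = d * g" using g_pos by (cases g) auto
  ultimately have "(c (d * g - d), c 0) \<in> E ^^ d" using c_mult[of 0 d] by simp
  then have "(c (d * g - d), u) \<in> E ^^ (b + d)" using b relpow_trans by (metis add.commute)
  then obtain x where "(c (d * g - d), x) \<in> E ^^ b" "(x, u) \<in> E ^^ d" by (auto simp: relpow_add)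
  then show ?thesis using relpow_subset_Times[OF E _ c_in] by blast
qed

section \<open>Class sizes and the construction of closed walks\<close>

text \<open>Averaging: the \<gamma> classes partition \<open>V\<close>.\<close>

lemma small_class: "\<exists>s<\<gamma>. \<gamma> * card {v \<in> V. cl v = s} \<le> card V"
proof (rule ccontr)
  assume "\<not> ?thesis"
  then have "(\<Sum>s<\<gamma>. card V) < (\<Sum>s<\<gamma>. \<gamma> * card {v \<in> V. cl v = s})"
    using gamma_pos by (intro sum_strict_mono) (auto simp: not_le)
  also have "\<dots> = \<gamma> * (\<Sum>s<\<gamma>. card {v \<in> V. cl v = s})" by (simp add: sum_distrib_left)
  also have "(\<Sum>s<\<gamma>. card {v \<in> V. cl v = s}) = card V"
    by (subst card_UN_disjoint[symmetric]) (use fin cl_less in \<open>auto intro!: arg_cong[of _ _ card]\<close>)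
  finally show False by simp
qed

text \<open>The indices \<open>s + j * \<gamma>\<close> with \<open>j < g div \<gamma>\<close> all
  lie below \<open>g\<close>, where \<open>c\<close> is injective.\<close>

lemma card_cycle_in_class:
  assumes "s < \<gamma>"
  shows "g div \<gamma> \<le> card (range c \<inter> {v \<in> V. cl v = s})"
proof -
  have lt: "s + j * \<gamma> < g" if "j < g div \<gamma>" for j
  proof -
    have "s + j * \<gamma> < Suc j * \<gamma>" using assms by simp
    also have "\<dots> \<le> g div \<gamma> * \<gamma>" using that by (intro mult_le_mono1) simp
    finally show ?thesis using gamma_dvd_g by simp
  qed
  have "inj_on (\<lambda>j. c (s + j * \<gamma>)) {..<g div \<gamma>}"
  proof (rule inj_onI)
    fix i j assume "i \<in> {..<g div \<gamma>}" "j \<in> {..<g div \<gamma>}" "c (s + i * \<gamma>) = c (s + j * \<gamma>)"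
    then have "s + i * \<gamma> = s + j * \<gamma>" using lt by (intro inj_onD[OF c_inj]) auto
    then show "i = j" using gamma_pos by simp
  qed
  then have "g div \<gamma> = card ((\<lambda>j. c (s + j * \<gamma>)) ` {..<g div \<gamma>})" by (simp add: card_image)
  also have "\<dots> \<le> card (range c \<inter> {v \<in> V. cl v = s})"
    using fin assms by (intro card_mono) (auto simp: c_in cl_c)
  finally show ?thesis .
qed

text \<open>The walk visits \<open>i\<close>, \<open>x\<close>, \<open>c t\<close>,
  \<open>c (t + q)\<close>, \<open>y\<close>, \<open>i\<close>, with segments of lengths
  \<open>d\<close>, \<open>\<gamma> * k\<close>, \<open>q\<close>, \<open>g * (m - 1)\<close> and
  \<open>d'\<close>.\<close>

lemma closed_walk_exists:
  assumes s: "s < \<gamma>" and i: "i \<in> V" and n: "\<gamma> dvd n"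
    and m: "m = card {v \<in> V. cl v = s}"
    and bound: "(if cl i = s then 0 else \<gamma>) + \<gamma> * (m - g div \<gamma>) + g * (m - 1) \<le> n"
  shows "(i, i) \<in> E ^^ n"
proof -
  let ?S = "{v \<in> V. cl v = s}"
  let ?d0 = "if cl i = s then 0 else \<gamma>"
  have finS: "finite ?S" using fin by simp
  \<comment> \<open>Entering the class takes \<open>d\<close> steps and the return to
    \<open>i\<close> takes \<open>d'\<close>; together they make up no turn or exactly one turn
    through the classes.\<close>
  obtain d d' where d: "(cl i + d) mod \<gamma> = s" "d + d' = ?d0"
  proof (cases "cl i = s")
    case True
    then show ?thesis using that[of 0 0] s by simp
  next
    case False
    have "cl i < \<gamma>" by (rule cl_less)
    then consider "cl i < s" | "s < cl i" using False by linarith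
    then show ?thesis
    proof cases
      case 1
      then show ?thesis using that[of "s - cl i" "\<gamma> - (s - cl i)"] s by simp
    next
      case 2
      then show ?thesis using that[of "\<gamma> + s - cl i" "cl i - s"] s \<open>cl i < \<gamma>\<close> by simp
    qed
  qed
  obtain x where x: "(i, x) \<in> E ^^ d" using walk_from i by blast
  have xS: "x \<in> ?S" using relpow_subset_Times[OF E x i] cl_walk[OF i x] d by simp
  obtain y where y: "y \<in> V" "(y, i) \<in> E ^^ d'" using walk_into i by blast
  have "[cl y + d' = s + d'] (mod \<gamma>)"
  proof -
    have "(cl y + d') mod \<gamma> = cl i" using cl_walk[OF y] by simp
    moreover have "(s + d') mod \<gamma> = (cl i + (d + d')) mod \<gamma>"
      using d(1) by (metis add.assoc mod_add_left_eq)
    moreover have "\<dots> = cl i" using d(2) cl_less[of i] by auto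
    ultimately show ?thesis by (simp add: cong_def)
  qed
  then have "[cl y = s] (mod \<gamma>)" by (simp only: cong_add_rcancel_nat)
  then have yS: "y \<in> ?S" using y cl_less[of y] s by (simp add: cong_def)
  let ?T = "range c \<inter> ?S"
  have cS: "c s \<in> ?T" using s by (simp add: c_in cl_c)
  have "\<exists>k \<le> card ?S - card ?T. \<exists>t\<in>?T. (x, t) \<in> (Restr (E ^^ \<gamma>) ?S) ^^ k"
  proof (rule relpow_hits_within_card[OF finS _ _ _ xS])
    fix u assume u: "u \<in> ?S"
    then obtain a where a: "(u, c s) \<in> E ^^ a" using walk_exists c_in by blast
    then have "\<gamma> dvd a" using u s dvd_walk_length cl_c by auto
    then show "\<exists>t\<in>?T. (u, t) \<in> (Restr (E ^^ \<gamma>) ?S)\<^sup>*"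
      using walk_to_rtrancl_in_class[of u "c s" \<gamma>] a u cS by (auto elim!: dvdE)
  qed auto
  then obtain k t where k: "k \<le> m - card ?T" and t: "c t \<in> ?S"
    and xt: "(x, c t) \<in> (Restr (E ^^ \<gamma>) ?S) ^^ k" using m by auto
  have xt': "(x, c t) \<in> E ^^ (\<gamma> * k)" using relpow_of_relpow[OF relpow_Restr[OF xt]] .
  have k': "k \<le> m - g div \<gamma>" using k card_cycle_in_class[OF s] by linarith
  \<comment> \<open>The surplus is spent on \<open>c\<close>. As \<gamma> divides it, the walk is
    again in the class afterwards.\<close>
  define q where "q = n - ?d0 - \<gamma> * k - g * (m - 1)"
  have "\<gamma> * k \<le> \<gamma> * (m - g div \<gamma>)" using k' by simp
  then have nq: "n = ?d0 + \<gamma> * k + q + g * (m - 1)" using bound unfolding q_def by linarith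
  have "\<gamma> dvd q" unfolding q_def using n gamma_dvd_g by (intro dvd_diff_nat) auto
  let ?z = "c (t + q)"
  have zS: "?z \<in> ?S" using t \<open>\<gamma> dvd q\<close> by (auto simp: c_in cl_c elim!: dvdE)
  have "\<exists>k \<le> card ?S - card {y}. \<exists>w\<in>{y}. (?z, w) \<in> (Restr (E ^^ g) ?S) ^^ k"
  proof (rule relpow_hits_within_card[OF finS _ _ _ zS])
    fix u assume u: "u \<in> ?S"
    then obtain a where a: "(u, y) \<in> E ^^ (g * a)" using walk_multiple_g[of u y] yS by auto
    show "\<exists>w\<in>{y}. (u, w) \<in> (Restr (E ^^ g) ?S)\<^sup>*"
      using walk_to_rtrancl_in_class[OF a _ gamma_dvd_g] u by auto
  qed (use yS in auto)
  then obtain k2 where k2: "k2 \<le> m - 1" "(?z, y) \<in> (Restr (E ^^ g) ?S) ^^ k2" using m by auto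
  have zy: "(?z, y) \<in> E ^^ (g * k2)" using relpow_of_relpow[OF relpow_Restr[OF k2(2)]] .
  \<comment> \<open>Full turns around \<open>c\<close> at \<open>?z\<close> pad the number of
    \<open>g\<close>-steps from \<open>k2\<close> to exactly \<open>m - 1\<close>.\<close>
  have "(?z, y) \<in> E ^^ ((m - 1 - k2) * g + g * k2)"
    using relpow_closed_mult[OF c_loop] zy by (rule relpow_trans)
  moreover have "(m - 1 - k2) * g + g * k2 = g * (m - 1)"
    using k2(1) by (metis add_mult_distrib2 le_add_diff_inverse2 mult.commute)
  ultimately have "(?z, y) \<in> E ^^ (g * (m - 1))" by simp
  then have "(i, i) \<in> E ^^ (d + \<gamma> * k + q + g * (m - 1) + d')"
    using relpow_trans[OF relpow_trans[OF relpow_trans[OF relpow_trans[OF x xt'] c_walk[of t q]]] y(2)]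
    by blast
  moreover have "d + \<gamma> * k + q + g * (m - 1) + d' = n" using nq d(2) by linarith
  ultimately show ?thesis by simp
qed

section \<open>Comparison with the two bounds\<close>

lemma closed_walks_beyond_bound:
  defines "N \<equiv> card V"
  shows "\<exists>e::int. (\<forall>i\<in>V. \<forall>n\<ge>e. int \<gamma> dvd n \<longrightarrow> (\<exists>k. int k = n \<and> (i, i) \<in> E ^^ k)) \<and>
    real_of_int e \<le> min (real N + (real N - 2) * real g)
      (2 * (real g / real \<gamma>) * real N - real g / real \<gamma> - 2 * real g + real \<gamma>)"
proof -
  obtain s where s: "s < \<gamma>" and small: "\<gamma> * card {v \<in> V. cl v = s} \<le> N"
    using small_class unfolding N_def by blast
  define m where "m = card {v \<in> V. cl v = s}"
  define h where "h = g div \<gamma>"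
  have g: "g = \<gamma> * h" using gamma_dvd_g by (simp add: h_def)
  then have h1: "1 \<le> h" using g_pos by (cases h) auto
  have hm: "h \<le> m"
    unfolding m_def h_def using fin
    by (intro order_trans[OF card_cycle_in_class[OF s]] card_mono) auto
  have mN: "\<gamma> * m \<le> N" using small by (simp add: m_def)
  have N1: "1 \<le> N" using mN hm h1 gamma_pos by (cases N) auto
  define M where "M = \<gamma> * (m - h) + g * (m - 1)"
  have M_real: "real M = real \<gamma> * real m + real g * real m - 2 * real g"
  proof -
    have "real M = real \<gamma> * (real m - real h) + real g * (real m - 1)"
      using hm h1 by (simp add: M_def of_nat_diff)
    then show ?thesis using g by (simp add: algebra_simps)
  qed
  have "real g * real m = real h * real (\<gamma> * m)" by (simp add: g)
  also have "\<dots> \<le> real h * real N" using mN by (intro mult_left_mono) linarith+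
  finally have M_le: "real M \<le> real N + real h * real N - 2 * real g"
    using mN[THEN of_nat_mono, where ?'a = real] M_real by simp
  have gh: "real g / real \<gamma> = real h" using gamma_pos by (simp add: g)
  \<comment> \<open>The second bound exceeds the estimate \<open>M_le\<close> by
    \<open>(h - 1) * (N - 1) + \<gamma> - 1\<close>, which leaves room for \<open>M + 1\<close> when
    \<gamma> is at least 2.\<close>
  have hN: "0 \<le> (real h - 1) * (real N - 1)" using h1 N1 by simp
  have "\<gamma> dvd M" by (simp add: M_def g)
  show ?thesis
  proof (cases "\<gamma> = 1")
    case True
    \<comment> \<open>There is only one class, so no steps are spent on entering it.\<close>
    have cl: "cl i = s" for i using cl_less[of i] s True by simp
    have "(i, i) \<in> E ^^ nat n" if "i \<in> V" "int M \<le> n" for i n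
    proof (rule closed_walk_exists[OF s that(1) _ m_def])
      have "M \<le> nat n" using that(2) by simp
      then show "(if cl i = s then 0 else \<gamma>) + \<gamma> * (m - g div \<gamma>) + g * (m - 1) \<le> nat n"
        unfolding M_def h_def cl by simp
    qed (simp add: True)
    then have "\<forall>i\<in>V. \<forall>n\<ge>int M. int \<gamma> dvd n \<longrightarrow> (\<exists>k. int k = n \<and> (i, i) \<in> E ^^ k)"
      by (intro ballI allI impI exI[of _ "nat _"]) auto
    moreover have "real h = real g" using g True by simp
    ultimately show ?thesis
      using M_le hN gh True by (intro exI[of _ "int M"]) (simp add: algebra_simps)
  next
    case False
    then have g2: "2 \<le> \<gamma>" using gamma_pos by simp
    have "(i, i) \<in> E ^^ nat n" if "i \<in> V" "int M + 1 \<le> n" "int \<gamma> dvd n" for i n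
    proof (rule closed_walk_exists[OF s that(1) _ m_def])
      \<comment> \<open>Multiples of \<gamma> above \<open>M\<close> are at least
        \<open>M + \<gamma>\<close>, which pays for entering and leaving the class.\<close>
      have "int \<gamma> dvd n - int M" using that(3) \<open>\<gamma> dvd M\<close> by (intro dvd_diff) auto
      then have "int \<gamma> \<le> n - int M" using that(2) by (intro zdvd_imp_le) auto
      then have "\<gamma> + M \<le> nat n" by linarith
      then show "(if cl i = s then 0 else \<gamma>) + \<gamma> * (m - g div \<gamma>) + g * (m - 1) \<le> nat n"
        unfolding M_def h_def by simp
      show "\<gamma> dvd nat n" using that by (subst int_dvd_int_iff[symmetric]) simp
    qed
    then have "\<forall>i\<in>V. \<forall>n\<ge>int M + 1. int \<gamma> dvd n \<longrightarrow> (\<exists>k. int k = n \<and> (i, i) \<in> E ^^ k)"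
      by (intro ballI allI impI exI[of _ "nat _"]) auto
    \<comment> \<open>This makes room for \<open>M + 1\<close> below the first bound, since
      \<open>g\<close> is at least \<open>2 * h\<close>.\<close>
    moreover have "real h * real N + 1 \<le> real g * real N"
    proof -
      have "1 \<le> h * N" using h1 N1 by simp
      moreover have "2 * (h * N) \<le> \<gamma> * (h * N)" using g2 by (rule mult_le_mono1)
      ultimately have "h * N + 1 \<le> g * N" unfolding g mult.assoc by linarith
      then show ?thesis by (metis of_nat_1 of_nat_add of_nat_le_iff of_nat_mult)
    qed
    ultimately show ?thesis
      using M_le hN gh g2 by (intro exI[of _ "int M + 1"]) (simp add: algebra_simps)
  qed
qed

end

section \<open>Walks, cyclicity and girth of a digraph\<close>

context pair_wf_digraph
begin

text \<open>Membership of \<open>u\<close> is explicit because the power 0 relates every element of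
  the type to itself, while an empty walk sits at a node.\<close>

lemma awalk_length_iff_relpow:
  "(\<exists>p. awalk u p v \<and> length p = n) \<longleftrightarrow> u \<in> pverts G \<and> (u, v) \<in> parcs G ^^ n"
proof (induction n arbitrary: u)
  case 0
  show ?case by (auto simp: awalk_Nil_iff)
next
  case (Suc n)
  have "(\<exists>p. awalk u p v \<and> length p = Suc n) \<longleftrightarrow>
      (\<exists>w. (u, w) \<in> parcs G \<and> (\<exists>p. awalk w p v \<and> length p = n))"
  proof
    assume "\<exists>p. awalk u p v \<and> length p = Suc n"
    then obtain e p where "awalk u (e # p) v" "length p = n" by (auto simp: length_Suc_conv)
    then have "(u, snd e) \<in> parcs G" "awalk (snd e) p v" by (auto simp: awalk_Cons_iff)
    then show "\<exists>w. (u, w) \<in> parcs G \<and> (\<exists>p. awalk w p v \<and> length p = n)"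
      using \<open>length p = n\<close> by blast
  next
    assume "\<exists>w. (u, w) \<in> parcs G \<and> (\<exists>p. awalk w p v \<and> length p = n)"
    then obtain w p where "(u, w) \<in> parcs G" "awalk w p v" "length p = n" by blast
    then show "\<exists>p. awalk u p v \<and> length p = Suc n"
      by (intro exI[of _ "(u, w) # p"]) (simp add: awalk_Cons_iff)
  qed
  also have "\<dots> \<longleftrightarrow> u \<in> pverts G \<and> (u, v) \<in> parcs G ^^ Suc n"
    unfolding Suc.IH using relpow_Suc_D2[of u v n "parcs G"] relpow_Suc_I2[of u _ "parcs G" v n]
    by (blast dest: in_arcsD1 in_arcsD2)
  finally show ?case .
qed

text \<open>Cutting out a closed proper subwalk leaves a closed walk. Both pieces are nonempty,
  hence shorter, which drives the inductions for cyclicity and girth.\<close>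

lemma closed_walk_not_cycleE:
  assumes "awalk u p u" "\<not> walk_cycle (with_proj G) p"
  obtains v q r where "awalk v q v" "awalk u r u" "q \<noteq> []" "length p = length q + length r" "r \<noteq> []"
proof -
  obtain q v where q: "strict_sublist q p" "q \<noteq> []" "awalk v q v"
    using assms unfolding walk_cycle_def by blast
  obtain a b where p: "p = a @ q @ b" using q(1) by (auto simp: strict_sublist_def sublist_def)
  have "a @ b \<noteq> []" using p q(1) by (auto simp: strict_sublist_def)
  obtain x y where ax: "awalk u a x" and xy: "awalk x q y" and yb: "awalk y b u"
    using assms(1) unfolding p by auto
  have "x = v" "y = v" using awalk_ends[OF xy q(3)] q(2) by auto
  then have "awalk u (a @ b) u" using ax yb by (metis awalk_appendI)
  then show thesis using that[OF q(3) _ q(2), of "a @ b"] p \<open>a @ b \<noteq> []\<close> by simp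
qed

lemma cyclicity_dvd_closed_walk: "awalk u p u \<Longrightarrow> cyclicity (with_proj G) dvd length p"
proof (induction "length p" arbitrary: u p rule: less_induct)
  case less
  show ?case
  proof (cases "walk_cycle (with_proj G) p")
    case True
    then show ?thesis unfolding cyclicity_def by (intro Gcd_dvd) auto
  next
    case False
    with less.prems show ?thesis
    proof (rule closed_walk_not_cycleE)
      fix v q r
      assume "awalk v q v" "awalk u r u" "q \<noteq> []" "length p = length q + length r" "r \<noteq> []"
      then show ?thesis using less.hyps[of q v] less.hyps[of r u] by simp
    qed
  qed
qed

text \<open>Closed walks decompose into cycles, so allowing all closed walks does not change the
  gcd.\<close>

lemma cyclicity_eq_Gcd: "cyclicity (with_proj G) = Gcd {n. \<exists>u. (u, u) \<in> parcs G ^^ n}"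
proof (rule dvd_antisym)
  show "cyclicity (with_proj G) dvd Gcd {n. \<exists>u. (u, u) \<in> parcs G ^^ n}"
  proof (rule Gcd_greatest, clarify)
    fix n u assume n: "(u, u) \<in> parcs G ^^ n"
    show "cyclicity (with_proj G) dvd n"
    proof (cases n)
      case (Suc k)
      then have "u \<in> pverts G" using n by (auto dest: in_arcsD2)
      then show ?thesis using n awalk_length_iff_relpow cyclicity_dvd_closed_walk by metis
    qed simp
  qed
  show "Gcd {n. \<exists>u. (u, u) \<in> parcs G ^^ n} dvd cyclicity (with_proj G)"
    unfolding cyclicity_def
  proof (rule Gcd_greatest, clarify)
    fix p assume "walk_cycle (with_proj G) p"
    then obtain u where "awalk u p u" unfolding walk_cycle_def by blast
    then have "(u, u) \<in> parcs G ^^ length p" using awalk_length_iff_relpow by blast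
    then show "Gcd {n. \<exists>u. (u, u) \<in> parcs G ^^ n} dvd length p" by (auto intro: Gcd_dvd)
  qed
qed

lemma girth_le_closed_walk: "awalk u p u \<Longrightarrow> p \<noteq> [] \<Longrightarrow> girth (with_proj G) \<le> length p"
proof (induction "length p" arbitrary: u p rule: less_induct)
  case less
  show ?case
  proof (cases "walk_cycle (with_proj G) p")
    case True
    then show ?thesis using less.prems unfolding girth_def by (intro Least_le) auto
  next
    case False
    with less.prems(1) show ?thesis
    proof (rule closed_walk_not_cycleE)
      fix v q r
      assume "awalk v q v" "awalk u r u" "q \<noteq> []" "length p = length q + length r" "r \<noteq> []"
      then show ?thesis using less.hyps[of q v] by simp
    qed
  qed
qed

text \<open>A repeated node among the first \<open>g\<close> would close up a nonempty walk shorter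
  than \<open>g\<close>, against \<open>girth_le_closed_walk\<close>.\<close>

lemma girth_cycle_sequence:
  assumes "\<exists>p. walk_cycle (with_proj G) p \<and> p \<noteq> []"
  defines "g \<equiv> girth (with_proj G)"
  shows "0 < g" and "\<exists>c. (\<forall>t. (c t, c (Suc t)) \<in> parcs G) \<and> (\<forall>t. c (t + g) = c t) \<and> inj_on c {..<g}"
proof -
  have "\<exists>p. walk_cycle (with_proj G) p \<and> p \<noteq> [] \<and> length p = g"
    unfolding g_def girth_def by (rule LeastI_ex) (use assms(1) in auto)
  then obtain p u where p: "awalk u p u" "p \<noteq> []" "length p = g"
    unfolding walk_cycle_def by blast
  then show g0: "0 < g" by auto
  have "(u, u) \<in> parcs G ^^ g" using p awalk_length_iff_relpow by blast
  then obtain f where f: "f 0 = u" "f g = u" "\<And>i. i < g \<Longrightarrow> (f i, f (Suc i)) \<in> parcs G"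
    by (auto simp: relpow_fun_conv)
  define c where "c t = f (t mod g)" for t
  have arc: "(c t, c (Suc t)) \<in> parcs G" for t
    using f(3)[of "t mod g"] f(1,2) g0 by (auto simp: c_def mod_Suc)
  have walk: "(c t, c (t + k)) \<in> parcs G ^^ k" for t k
    by (induction k) (auto intro: arc)
  have neq: "c i \<noteq> c j" if "i < j" "j < g" for i j
  proof
    assume "c i = c j"
    then have "(c i, c i) \<in> parcs G ^^ (j - i)" using walk[of i "j - i"] that by simp
    then obtain q where "awalk (c i) q (c i)" "length q = j - i"
      using awalk_length_iff_relpow arc in_arcsD1 by metis
    then have "g \<le> j - i" using girth_le_closed_walk[of "c i" q] that unfolding g_def by force
    then show False using that by simp
  qed
  then have "inj_on c {..<g}" by (intro linorder_inj_onI) auto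
  then show "\<exists>c. (\<forall>t. (c t, c (Suc t)) \<in> parcs G) \<and> (\<forall>t. c (t + g) = c t) \<and> inj_on c {..<g}"
    using arc by (intro exI[of _ c]) (simp add: c_def)
qed

end

section \<open>Existence of the penalty and conclusion\<close>

lemma least_int_exists:
  fixes P :: "int \<Rightarrow> bool"
  assumes "P e" and lower: "\<And>x. P x \<Longrightarrow> b \<le> x"
  shows "\<exists>l. P l \<and> (\<forall>x. P x \<longrightarrow> l \<le> x)"
proof -
  let ?Q = "\<lambda>k. P (b + int k)"
  have "?Q (nat (e - b))" using assms by simp
  then have "?Q (Least ?Q)" by (rule LeastI)
  moreover have "b + int (Least ?Q) \<le> x" if "P x" for x
    using Least_le[of ?Q "nat (x - b)"] that lower[OF that] by simp
  ultimately show ?thesis by blast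
qed

theorem theorem3:
  fixes G :: "'a pair_pre_digraph" and N g \<gamma> :: nat
  assumes "pair_fin_digraph G"
    and "strongly_connected (with_proj G)"
    and "\<exists>p. walk_cycle (with_proj G) p \<and> p \<noteq> []"
    and "N = card (pverts G)"
    and "g = girth (with_proj G)"
    and "\<gamma> = cyclicity (with_proj G)"
  shows "finite_exploration_penalty (with_proj G) \<and>
    real_of_int (exploration_penalty (with_proj G)) \<le>
      min (real N + (real N - 2) * real g)
          (2 * (real g / real \<gamma>) * real N - real g / real \<gamma> - 2 * real g + real \<gamma>)"
proof -
  interpret pair_fin_digraph G by fact
  let ?P = "closed_walks_from (with_proj G)"
  obtain c where c: "\<And>t. (c t, c (Suc t)) \<in> parcs G" "\<And>t. c (t + g) = c t" "inj_on c {..<g}"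
    using girth_cycle_sequence(2)[OF assms(3)] unfolding assms(5) by blast
  interpret cyclic_relation "pverts G" "parcs G" g \<gamma> c
  proof
    fix u v assume uv: "u \<in> pverts G" "v \<in> pverts G"
    then have "u \<rightarrow>\<^sup>*\<^bsub>with_proj G\<^esub> v" using assms(2) by (auto simp: strongly_connected_def)
    then obtain p where "awalk u p v" unfolding reachable_awalk by blast
    then have "(u, v) \<in> parcs G ^^ length p" using awalk_length_iff_relpow by blast
    then show "(u, v) \<in> (parcs G)\<^sup>*" by (rule relpow_imp_rtrancl)
  next
    show "0 < g" using girth_cycle_sequence(1)[OF assms(3)] assms(5) by simp
    show "\<gamma> = Gcd {n. \<exists>u. (u, u) \<in> parcs G ^^ n}" using cyclicity_eq_Gcd assms(6) by simp
    show "parcs G \<subseteq> pverts G \<times> pverts G" using in_arcsD1 in_arcsD2 by auto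
  qed (use c pair_finite_verts in auto)
  have P_iff: "?P e \<longleftrightarrow> (\<forall>i\<in>pverts G. \<forall>n\<ge>e. int \<gamma> dvd n \<longrightarrow> (\<exists>k. int k = n \<and> (i, i) \<in> parcs G ^^ k))" for e
    unfolding closed_walks_from_def assms(6) with_proj_simps
    by (intro ball_cong refl all_cong imp_cong) (metis awalk_length_iff_relpow)
  obtain e where e: "?P e" "real_of_int e \<le> min (real N + (real N - 2) * real g)
      (2 * (real g / real \<gamma>) * real N - real g / real \<gamma> - 2 * real g + real \<gamma>)"
    using closed_walks_beyond_bound unfolding P_iff assms(4) by blast
  \<comment> \<open>Below this value the negative multiple \<open>- int \<gamma>\<close> would have
    to be the length of a closed walk at \<open>c 0\<close>. Hence the valid integers are bounded
    below and a least one exists.\<close>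
  have "- int \<gamma> \<le> x" if "?P x" for x
  proof (rule ccontr)
    assume "\<not> - int \<gamma> \<le> x"
    then have "\<exists>k. int k = - int \<gamma>" using that[unfolded P_iff, rule_format, OF c_in[of 0], of "- int \<gamma>"] by auto
    then show False using gamma_pos by auto
  qed
  then obtain l where l: "?P l" "\<And>x. ?P x \<Longrightarrow> l \<le> x"
    using least_int_exists[of ?P, OF e(1)] by blast
  then have "exploration_penalty (with_proj G) = l"
    unfolding exploration_penalty_def by (intro Least_equality)
  moreover have "finite_exploration_penalty (with_proj G)"
    unfolding finite_exploration_penalty_def using l by blast
  moreover have "real_of_int l \<le> real_of_int e" using l(2)[OF e(1)] by simp
  ultimately show ?thesis using e(2) by linarith
qed

end
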